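(* Let $R$ be a commutative ring with unit, and let $(A,d)$ be a differential graded $R$-algebra such that $A$ is a graded algebra with cup-one products, also endowed with an $R$-linear map $\cup_1\colon A^1\otimes_R A^2\to A^2$ and with an $R$-linear map $\circ\colon D^2(A)\otimes_R D^2(A)\to D^2(A)$ satisfying $(u\cup v)\circ(w\cup z)=(u\cup_1 w)\cup(v\cup_1 z)$ for all $u,v,w,z\in A^1$. Suppose the following two conditions hold. (1) For all $a,b,c\in A^1$ with $da\in D^2(A)$, $$a\cup_1(b\cup c)=da\circ(b\cup c)-(b\cup c)\cup_1 a .$$ (2) For all $a,b\in A^1$, $$d(a\cup_1 b)=-a\cup b-b\cup a+da\cup_1 b-a\cup_1 db .$$ Then for all $a,b\in A^1$ with $da,db\in D^2(A)$, $$d(a\cup_1 b)=-a\cup b-b\cup a+da\cup_1 b+db\cup_1 a-da\circ db ,$$ and so $(A,d)$ is a $\cup_1$-dga. In particular, if $A$ is a dga with Steenrod products, whose $\cup_1$ operation makes $A$ a graded algebra with cup-one products, and there is an $R$-linear map $\circ\colon D^2(A)\otimes_R D^2(A)\to D^2(A)$ satisfying $(u\cup v)\circ(w\cup z)=(u\cup_1 w)\cup(v\cup_1 z)$ for all $u,v,w,z\in A^1$ and such that (1) holds, then $A$ is a $\cup_1$-dga.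
   Context: Graded $R$-algebras $A=\bigoplus_{i\ge0}A^i$ are associative and unital, with injective structure map $R\to A$, so that $R\subset A^0$; the product is denoted $a\cup b$. A differential graded $R$-algebra (dga) is a graded $R$-algebra with an $R$-linear degree $1$ map $d$ with $d^2=0$ and $d(a\cup b)=da\cup b+(-1)^{|a|}a\cup db$ for homogeneous $a,b$. $D^2(A)\subseteq A^2$ is the $R$-submodule spanned by all $a\cup b$ with $a,b\in A^1$. A graded algebra with cup-one products is a graded $R$-algebra $A$ with $R$-linear maps $\cup_1\colon A^p\otimes_R A^1\to A^p$ for $p=1,2$ such that (i) $(a\cup b)\cup_1 c=a\cup(b\cup_1 c)+(a\cup_1 c)\cup b$ for all $a,b,c\in A^1$; (ii) the $R$-module $R\oplus A^1$, with multiplication $(r+a)(s+b)=rs+(rb+sa+a\cup_1 b)$, is a commutative ring. A $\cup_1$-dga is a differential graded $R$-algebra $(A,d)$ such that $A$ is a graded algebra with cup-one products, there is an $R$-linear map $\circ\colon D^2(A)\otimes_R D^2(A)\to D^2(A)$ with $(u\cup v)\circ(w\cup z)=(u\cup_1 w)\cup(v\cup_1 z)$ for all $u,v,w,z\in A^1$, and $d(a\cup_1 b)=-a\cup b-b\cup a+da\cup_1 b+db\cup_1 a-da\circ db$ for all $a,b\in A^1$ with $da,db\in D^2(A)$. A dga with Steenrod products is an $R$-dga with $R$-linear maps $\cup_i\colon A^p\otimes_R A^q\to A^{p+q-i}$ ($i\ge 0$), equal to the cup product for $i=0$, vanishing if $p<i$ or $q<i$, and satisfying for all homogeneous $a,b,c$: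 $d(a\cup_i b)=(-1)^{|a|+|b|-i}a\cup_{i-1}b+(-1)^{|a||b|+|a|+|b|}b\cup_{i-1}a+da\cup_i b+(-1)^{|a|}a\cup_i db$ for $i\ge1$, and $(a\cup b)\cup_1 c=a\cup(b\cup_1 c)+(-1)^{|b|(|c|-1)}(a\cup_1 c)\cup b$. *)

theory Defs
  imports "HOL-Algebra.Module" "HOL.Hull"
begin

text \<open>Linear maps out of a tensor product of submodules are rendered as bilinear maps
  (universal property of the tensor product).\<close>

definition linear_on ::
  "('r, 'm) ring_scheme \<Rightarrow> ('r, 'a, 'n) module_scheme \<Rightarrow> 'a set \<Rightarrow> 'a set \<Rightarrow> ('a \<Rightarrow> 'a) \<Rightarrow> bool"
  where "linear_on R A U V f \<longleftrightarrow>
    f \<in> U \<rightarrow> V \<and>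
    (\<forall>x\<in>U. \<forall>y\<in>U. f (x \<oplus>\<^bsub>A\<^esub> y) = f x \<oplus>\<^bsub>A\<^esub> f y) \<and>
    (\<forall>r\<in>carrier R. \<forall>x\<in>U. f (r \<odot>\<^bsub>A\<^esub> x) = r \<odot>\<^bsub>A\<^esub> f x)"

definition bilinear_on ::
  "('r, 'm) ring_scheme \<Rightarrow> ('r, 'a, 'n) module_scheme \<Rightarrow>
    'a set \<Rightarrow> 'a set \<Rightarrow> 'a set \<Rightarrow> ('a \<Rightarrow> 'a \<Rightarrow> 'a) \<Rightarrow> bool"
  where "bilinear_on R A U V W f \<longleftrightarrow>
    (\<forall>v\<in>V. linear_on R A U W (\<lambda>u. f u v)) \<and> (\<forall>u\<in>U. linear_on R A V W (f u))"

text \<open>\<open>signed A k a\<close> is $(-1)^k a$. The exponent is an integer because the exponents below may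
  be negative: $|a|+|b|-i = -1$ for $|a|=|b|=0$, $i=1$, and $|c|-1 = -1$ for $|c|=0$.\<close>

definition signed :: "('a, 'n) ring_scheme \<Rightarrow> int \<Rightarrow> 'a \<Rightarrow> 'a"
  where "signed A k a = (if even k then a else \<ominus>\<^bsub>A\<^esub> a)"

text \<open>The grading is internal: \<open>G i\<close> is the submodule $A^i$ of the underlying module of \<open>A\<close>.
  The base ring may be the zero ring.\<close>

locale graded_algebra = module R A + A: ring A
  for R :: "('r, 'm) ring_scheme" and A :: "('r, 'a, 'n) module_scheme" +
  fixes G :: "nat \<Rightarrow> 'a set"
  assumes smult_mult_left:
      "\<lbrakk>r \<in> carrier R; a \<in> carrier A; b \<in> carrier A\<rbrakk>
        \<Longrightarrow> (r \<odot>\<^bsub>A\<^esub> a) \<otimes>\<^bsub>A\<^esub> b = r \<odot>\<^bsub>A\<^esub> (a \<otimes>\<^bsub>A\<^esub> b)"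
    and smult_mult_right:
      "\<lbrakk>r \<in> carrier R; a \<in> carrier A; b \<in> carrier A\<rbrakk>
        \<Longrightarrow> a \<otimes>\<^bsub>A\<^esub> (r \<odot>\<^bsub>A\<^esub> b) = r \<odot>\<^bsub>A\<^esub> (a \<otimes>\<^bsub>A\<^esub> b)"
    and structure_map_inj: "inj_on (\<lambda>r. r \<odot>\<^bsub>A\<^esub> \<one>\<^bsub>A\<^esub>) (carrier R)"
    and structure_map_degree: "r \<in> carrier R \<Longrightarrow> r \<odot>\<^bsub>A\<^esub> \<one>\<^bsub>A\<^esub> \<in> G 0"
    and grading_submodule: "submodule (G i) R A"
    and grading_mult: "\<lbrakk>a \<in> G i; b \<in> G j\<rbrakk> \<Longrightarrow> a \<otimes>\<^bsub>A\<^esub> b \<in> G (i + j)"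
    and grading_direct_sum:
      "a \<in> carrier A \<Longrightarrow>
        \<exists>!f. (\<forall>i. f i \<in> G i) \<and> finite {i. f i \<noteq> \<zero>\<^bsub>A\<^esub>} \<and>
             a = (\<Oplus>\<^bsub>A\<^esub>i\<in>{i. f i \<noteq> \<zero>\<^bsub>A\<^esub>}. f i)"

locale dga = graded_algebra R A G
  for R :: "('r, 'm) ring_scheme" and A :: "('r, 'a, 'n) module_scheme" and G :: "nat \<Rightarrow> 'a set" +
  fixes d :: "'a \<Rightarrow> 'a"
  assumes d_linear: "linear_on R A (carrier A) (carrier A) d"
    and d_degree: "a \<in> G i \<Longrightarrow> d a \<in> G (Suc i)"
    and d_d: "a \<in> carrier A \<Longrightarrow> d (d a) = \<zero>\<^bsub>A\<^esub>"
    and d_mult: "\<lbrakk>a \<in> G i; b \<in> G j\<rbrakk>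
      \<Longrightarrow> d (a \<otimes>\<^bsub>A\<^esub> b) = d a \<otimes>\<^bsub>A\<^esub> b \<oplus>\<^bsub>A\<^esub> signed A (int i) (a \<otimes>\<^bsub>A\<^esub> d b)"

definition D2 ::
  "('r, 'm) ring_scheme \<Rightarrow> ('r, 'a, 'n) module_scheme \<Rightarrow> (nat \<Rightarrow> 'a set) \<Rightarrow> 'a set"
  where "D2 R A G = (\<lambda>H. submodule H R A) hull {a \<otimes>\<^bsub>A\<^esub> b |a b. a \<in> G 1 \<and> b \<in> G 1}"

text \<open>The ring structure on $R \oplus A^1$.\<close>

definition cup_one_ring ::
  "('r, 'm) ring_scheme \<Rightarrow> ('r, 'a, 'n) module_scheme \<Rightarrow> (nat \<Rightarrow> 'a set) \<Rightarrow>
    ('a \<Rightarrow> 'a \<Rightarrow> 'a) \<Rightarrow> ('r \<times> 'a) ring"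
  where "cup_one_ring R A G cup1 =
    \<lparr>carrier = carrier R \<times> G 1,
     monoid.mult = (\<lambda>(r, a) (s, b). (r \<otimes>\<^bsub>R\<^esub> s, r \<odot>\<^bsub>A\<^esub> b \<oplus>\<^bsub>A\<^esub> s \<odot>\<^bsub>A\<^esub> a \<oplus>\<^bsub>A\<^esub> cup1 a b)),
     one = (\<one>\<^bsub>R\<^esub>, \<zero>\<^bsub>A\<^esub>),
     zero = (\<zero>\<^bsub>R\<^esub>, \<zero>\<^bsub>A\<^esub>),
     add = (\<lambda>(r, a) (s, b). (r \<oplus>\<^bsub>R\<^esub> s, a \<oplus>\<^bsub>A\<^esub> b))\<rparr>"

text \<open>One function serves for the operations $A^p \otimes_R A^q \to A^{p+q-1}$ in several bidegrees
  $(p,q)$. This loses no generality: distinct pieces of the grading meet only in \<open>\<zero>\<close>, and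
  bilinearity forces the value \<open>\<zero>\<close> where two domains overlap.\<close>

locale cup_one_algebra = graded_algebra R A G
  for R :: "('r, 'm) ring_scheme" and A :: "('r, 'a, 'n) module_scheme" and G :: "nat \<Rightarrow> 'a set" +
  fixes cup1 :: "'a \<Rightarrow> 'a \<Rightarrow> 'a"
  assumes cup1_bilinear: "p \<in> {1, 2} \<Longrightarrow> bilinear_on R A (G p) (G 1) (G p) cup1"
    and hirsch: "\<lbrakk>a \<in> G 1; b \<in> G 1; c \<in> G 1\<rbrakk>
      \<Longrightarrow> cup1 (a \<otimes>\<^bsub>A\<^esub> b) c = a \<otimes>\<^bsub>A\<^esub> cup1 b c \<oplus>\<^bsub>A\<^esub> cup1 a c \<otimes>\<^bsub>A\<^esub> b"
    and cup_one_ring: "cring (cup_one_ring R A G cup1)"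

definition circ_product ::
  "('r, 'm) ring_scheme \<Rightarrow> ('r, 'a, 'n) module_scheme \<Rightarrow> (nat \<Rightarrow> 'a set) \<Rightarrow>
    ('a \<Rightarrow> 'a \<Rightarrow> 'a) \<Rightarrow> ('a \<Rightarrow> 'a \<Rightarrow> 'a) \<Rightarrow> bool"
  where "circ_product R A G cup1 circ \<longleftrightarrow>
    bilinear_on R A (D2 R A G) (D2 R A G) (D2 R A G) circ \<and>
    (\<forall>u\<in>G 1. \<forall>v\<in>G 1. \<forall>w\<in>G 1. \<forall>z\<in>G 1.
      circ (u \<otimes>\<^bsub>A\<^esub> v) (w \<otimes>\<^bsub>A\<^esub> z) = cup1 u w \<otimes>\<^bsub>A\<^esub> cup1 v z)"

definition cup1_d_formula ::
  "('r, 'm) ring_scheme \<Rightarrow> ('r, 'a, 'n) module_scheme \<Rightarrow> (nat \<Rightarrow> 'a set) \<Rightarrow>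
    ('a \<Rightarrow> 'a) \<Rightarrow> ('a \<Rightarrow> 'a \<Rightarrow> 'a) \<Rightarrow> ('a \<Rightarrow> 'a \<Rightarrow> 'a) \<Rightarrow> bool"
  where "cup1_d_formula R A G d cup1 circ \<longleftrightarrow>
    (\<forall>a\<in>G 1. \<forall>b\<in>G 1. d a \<in> D2 R A G \<longrightarrow> d b \<in> D2 R A G \<longrightarrow>
      d (cup1 a b) =
        \<ominus>\<^bsub>A\<^esub> (a \<otimes>\<^bsub>A\<^esub> b) \<ominus>\<^bsub>A\<^esub> b \<otimes>\<^bsub>A\<^esub> a \<oplus>\<^bsub>A\<^esub> cup1 (d a) b \<oplus>\<^bsub>A\<^esub> cup1 (d b) a \<ominus>\<^bsub>A\<^esub> circ (d a) (d b))"

locale cup1_dga = dga R A G d + cup_one_algebra R A G cup1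
  for R :: "('r, 'm) ring_scheme" and A :: "('r, 'a, 'n) module_scheme" and G :: "nat \<Rightarrow> 'a set"
    and d :: "'a \<Rightarrow> 'a" and cup1 :: "'a \<Rightarrow> 'a \<Rightarrow> 'a" +
  assumes circ_exists: "\<exists>circ. circ_product R A G cup1 circ \<and> cup1_d_formula R A G d cup1 circ"

text \<open>For \<open>i > p + q\<close> the target $A^{p+q-i}$ is zero; this case is covered by \<open>steenrod_vanish\<close>.\<close>

locale steenrod_dga = dga R A G d
  for R :: "('r, 'm) ring_scheme" and A :: "('r, 'a, 'n) module_scheme" and G :: "nat \<Rightarrow> 'a set"
    and d :: "'a \<Rightarrow> 'a" +
  fixes cup :: "nat \<Rightarrow> 'a \<Rightarrow> 'a \<Rightarrow> 'a"
  assumes steenrod_bilinear: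
      "i \<le> p + q \<Longrightarrow> bilinear_on R A (G p) (G q) (G (p + q - i)) (cup i)"
    and steenrod_0: "\<lbrakk>a \<in> G p; b \<in> G q\<rbrakk> \<Longrightarrow> cup 0 a b = a \<otimes>\<^bsub>A\<^esub> b"
    and steenrod_vanish: "\<lbrakk>a \<in> G p; b \<in> G q; p < i \<or> q < i\<rbrakk> \<Longrightarrow> cup i a b = \<zero>\<^bsub>A\<^esub>"
    and steenrod_d:
      "\<lbrakk>a \<in> G p; b \<in> G q; 1 \<le> i\<rbrakk> \<Longrightarrow>
        d (cup i a b) =
          signed A (int p + int q - int i) (cup (i - 1) a b) \<oplus>\<^bsub>A\<^esub>
          signed A (int p * int q + int p + int q) (cup (i - 1) b a) \<oplus>\<^bsub>A\<^esub>
          cup i (d a) b \<oplus>\<^bsub>A\<^esub> signed A (int p) (cup i a (d b))"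
    and steenrod_hirsch:
      "\<lbrakk>a \<in> G p; b \<in> G q; c \<in> G s\<rbrakk> \<Longrightarrow>
        cup 1 (a \<otimes>\<^bsub>A\<^esub> b) c =
          a \<otimes>\<^bsub>A\<^esub> cup 1 b c \<oplus>\<^bsub>A\<^esub> signed A (int q * (int s - 1)) (cup 1 a c \<otimes>\<^bsub>A\<^esub> b)"

end

theory Submission
  imports Defs
begin

text \<open>
  Let $a, b \<in> A^1$ with $da, db \<in> D^2(A)$. The formula for $d(a \cup_1 b)$ in condition (2) and
  the desired one differ only in that $-a \cup_1 db$ is replaced by $db \cup_1 a - da \circ db$.
  Condition (1) says that
  $a \cup_1 x = da \circ x - x \cup_1 a$ whenever $x$ is a product of two elements of $A^1$. Both
  sides are $R$-linear in $x \in D^2(A)$, so the identity holds on the submodule $D^2(A)$ that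
  these products span (\<open>cup1_eq_circ_minus_on_D2\<close>), and one applies it to $x = db$.
  For Steenrod products, the formula for $d(a \cup_i b)$ with $i = |a| = |b| = 1$ is condition (2)
  (\<open>steenrod_dga.d_cup_1\<close>).
\<close>

lemma linear_on_add:
  "\<lbrakk>linear_on R A U V f; x \<in> U; y \<in> U\<rbrakk> \<Longrightarrow> f (x \<oplus>\<^bsub>A\<^esub> y) = f x \<oplus>\<^bsub>A\<^esub> f y"
  by (simp add: linear_on_def)

lemma linear_on_smult:
  "\<lbrakk>linear_on R A U V f; r \<in> carrier R; x \<in> U\<rbrakk> \<Longrightarrow> f (r \<odot>\<^bsub>A\<^esub> x) = r \<odot>\<^bsub>A\<^esub> f x"
  by (simp add: linear_on_def)

lemma linear_on_closed: "\<lbrakk>linear_on R A U V f; x \<in> U\<rbrakk> \<Longrightarrow> f x \<in> V"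
  by (auto simp: linear_on_def)

lemma linear_on_subset: "\<lbrakk>linear_on R A U V f; U' \<subseteq> U; V \<subseteq> V'\<rbrakk> \<Longrightarrow> linear_on R A U' V' f"
  unfolding linear_on_def by blast

context module
begin

lemma submodule_zero_closed: "submodule H R M \<Longrightarrow> \<zero>\<^bsub>M\<^esub> \<in> H"
  using subgroup.one_closed[OF submodule.axioms(1)] by fastforce

lemma linear_on_diff:
  assumes f: "linear_on R M U (carrier M) f" and g: "linear_on R M U (carrier M) g"
  shows "linear_on R M U (carrier M) (\<lambda>x. f x \<ominus>\<^bsub>M\<^esub> g x)"
  using linear_on_closed[OF f] linear_on_closed[OF g]
  by (auto simp: linear_on_def linear_on_add[OF f] linear_on_add[OF g] linear_on_smult[OF f]
      linear_on_smult[OF g] a_minus_def M.minus_add M.a_ac smult_r_distr smult_r_minus)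

lemma submodule_equalizer:
  assumes H: "submodule H R M"
    and f: "linear_on R M H (carrier M) f" and g: "linear_on R M H (carrier M) g"
  shows "submodule {x \<in> H. f x = g x} R M"
proof (rule submoduleI)
  show "{x \<in> H. f x = g x} \<subseteq> carrier M"
    using submoduleE(1)[OF H] by blast
  have smult: "r \<odot>\<^bsub>M\<^esub> x \<in> {x \<in> H. f x = g x}"
    if "r \<in> carrier R" "x \<in> {x \<in> H. f x = g x}" for r x
    using that submoduleE(4)[OF H] by (simp add: linear_on_smult[OF f] linear_on_smult[OF g])
  then show "\<And>r x. \<lbrakk>r \<in> carrier R; x \<in> {x \<in> H. f x = g x}\<rbrakk>
      \<Longrightarrow> r \<odot>\<^bsub>M\<^esub> x \<in> {x \<in> H. f x = g x}" .
  show "\<ominus>\<^bsub>M\<^esub> x \<in> {x \<in> H. f x = g x}" if x: "x \<in> {x \<in> H. f x = g x}" for x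
  proof -
    have "\<ominus>\<^bsub>M\<^esub> x = (\<ominus>\<^bsub>R\<^esub> \<one>\<^bsub>R\<^esub>) \<odot>\<^bsub>M\<^esub> x"
      using x submoduleE(1)[OF H] smult_l_minus[of "\<one>\<^bsub>R\<^esub>" x] by auto
    then show ?thesis
      using smult[OF _ x] by simp
  qed
  have zero: "h \<zero>\<^bsub>M\<^esub> = \<zero>\<^bsub>M\<^esub>" if "linear_on R M H (carrier M) h" for h
    using linear_on_smult[OF that R.zero_closed submodule_zero_closed[OF H]]
      linear_on_closed[OF that submodule_zero_closed[OF H]] by (simp add: smult_l_null)
  then show "\<zero>\<^bsub>M\<^esub> \<in> {x \<in> H. f x = g x}"
    using zero[OF f] zero[OF g] submodule_zero_closed[OF H] by simp
qed (use submoduleE(5)[OF H] linear_on_add[OF f] linear_on_add[OF g] in auto)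

end

context graded_algebra
begin

lemma grading_closed: "a \<in> G i \<Longrightarrow> a \<in> carrier A"
  using submoduleE(1)[OF grading_submodule] by blast

lemma D2_subset_G2: "D2 R A G \<subseteq> G 2"
  unfolding D2_def
proof (rule hull_minimal)
  show "{a \<otimes>\<^bsub>A\<^esub> b |a b. a \<in> G 1 \<and> b \<in> G 1} \<subseteq> G 2"
    using grading_mult[of _ 1 _ 1] by (auto simp: numeral_2_eq_2)
qed (rule grading_submodule)

lemma mult_mem_D2: "\<lbrakk>a \<in> G 1; b \<in> G 1\<rbrakk> \<Longrightarrow> a \<otimes>\<^bsub>A\<^esub> b \<in> D2 R A G"
  unfolding D2_def by (rule hull_inc) blast

lemma D2_submodule: "submodule (D2 R A G) R A"
proof (rule submoduleI)
  show "D2 R A G \<subseteq> carrier A"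
    using D2_subset_G2 grading_closed by blast
qed (auto simp: D2_def hull_def submodule_zero_closed intro: submoduleE(3,4,5))

lemma linear_on_D2_eqI:
  assumes f: "linear_on R A (D2 R A G) (carrier A) f"
    and g: "linear_on R A (D2 R A G) (carrier A) g"
    and eq: "\<And>b c. \<lbrakk>b \<in> G 1; c \<in> G 1\<rbrakk> \<Longrightarrow> f (b \<otimes>\<^bsub>A\<^esub> c) = g (b \<otimes>\<^bsub>A\<^esub> c)"
    and x: "x \<in> D2 R A G"
  shows "f x = g x"
proof -
  have "{a \<otimes>\<^bsub>A\<^esub> b |a b. a \<in> G 1 \<and> b \<in> G 1} \<subseteq> {x \<in> D2 R A G. f x = g x}"
    using mult_mem_D2 eq by blast
  from hull_minimal[where S = "\<lambda>H. submodule H R A", OF this submodule_equalizer[OF D2_submodule f g]]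
  show ?thesis
    using x by (auto simp: D2_def)
qed

end

text \<open>Condition (1), extended by linearity from products to all of $D^2(A)$; the element \<open>w\<close>
  stands for $da$, of which only membership in $D^2(A)$ matters.\<close>

lemma (in cup_one_algebra) cup1_eq_circ_minus_on_D2:
  assumes bil: "bilinear_on R A (G 1) (G 2) (G 2) cup1"
    and circ: "circ_product R A G cup1 circ"
    and a: "a \<in> G 1" and w: "w \<in> D2 R A G"
    and eq: "\<And>b c. \<lbrakk>b \<in> G 1; c \<in> G 1\<rbrakk>
      \<Longrightarrow> cup1 a (b \<otimes>\<^bsub>A\<^esub> c) = circ w (b \<otimes>\<^bsub>A\<^esub> c) \<ominus>\<^bsub>A\<^esub> cup1 (b \<otimes>\<^bsub>A\<^esub> c) a"
    and x: "x \<in> D2 R A G"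
  shows "cup1 a x = circ w x \<ominus>\<^bsub>A\<^esub> cup1 x a"
proof (rule linear_on_D2_eqI[where f = "cup1 a", OF _ linear_on_diff eq x])
  have G2: "G 2 \<subseteq> carrier A"
    using grading_closed by blast
  have "linear_on R A (G 2) (G 2) (cup1 a)"
    using bil a by (simp add: bilinear_on_def)
  then show "linear_on R A (D2 R A G) (carrier A) (cup1 a)"
    by (rule linear_on_subset[OF _ D2_subset_G2 G2])
  have "linear_on R A (D2 R A G) (D2 R A G) (circ w)"
    using circ w by (simp add: circ_product_def bilinear_on_def)
  then show "linear_on R A (D2 R A G) (carrier A) (circ w)"
    by (rule linear_on_subset[OF _ subset_refl order_trans[OF D2_subset_G2 G2]])
  have "linear_on R A (G 2) (G 2) (\<lambda>x. cup1 x a)"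
    using cup1_bilinear[of 2] a by (simp add: bilinear_on_def)
  then show "linear_on R A (D2 R A G) (carrier A) (\<lambda>x. cup1 x a)"
    by (rule linear_on_subset[OF _ D2_subset_G2 G2])
qed

lemma cup1_d_formula_if_left_formula:
  assumes "dga R A G d" and "cup_one_algebra R A G cup1"
    and bil: "bilinear_on R A (G 1) (G 2) (G 2) cup1"
    and circ: "circ_product R A G cup1 circ"
    and left: "\<And>a b c. \<lbrakk>a \<in> G 1; b \<in> G 1; c \<in> G 1; d a \<in> D2 R A G\<rbrakk>
      \<Longrightarrow> cup1 a (b \<otimes>\<^bsub>A\<^esub> c) = circ (d a) (b \<otimes>\<^bsub>A\<^esub> c) \<ominus>\<^bsub>A\<^esub> cup1 (b \<otimes>\<^bsub>A\<^esub> c) a"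
    and d_cup1: "\<And>a b. \<lbrakk>a \<in> G 1; b \<in> G 1\<rbrakk> \<Longrightarrow> d (cup1 a b) =
      \<ominus>\<^bsub>A\<^esub> (a \<otimes>\<^bsub>A\<^esub> b) \<ominus>\<^bsub>A\<^esub> b \<otimes>\<^bsub>A\<^esub> a \<oplus>\<^bsub>A\<^esub> cup1 (d a) b \<ominus>\<^bsub>A\<^esub> cup1 a (d b)"
  shows "cup1_d_formula R A G d cup1 circ"
  unfolding cup1_d_formula_def
proof (intro ballI impI)
  interpret dga R A G d by fact
  interpret cup_one_algebra R A G cup1 by fact
  fix a b assume a: "a \<in> G 1" and b: "b \<in> G 1" and da: "d a \<in> D2 R A G" and db: "d b \<in> D2 R A G"
  have cup1_closed: "cup1 x y \<in> carrier A" if "x \<in> G 2" "y \<in> G 1" for x y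
  proof -
    have "linear_on R A (G 2) (G 2) (\<lambda>x. cup1 x y)"
      using cup1_bilinear[of 2] that(2) by (simp add: bilinear_on_def)
    from linear_on_closed[OF this that(1)] show ?thesis
      by (rule grading_closed)
  qed
  have "circ (d a) (d b) \<in> D2 R A G"
    using circ da db by (auto simp: circ_product_def bilinear_on_def linear_on_def Pi_iff)
  then have closed: "circ (d a) (d b) \<in> carrier A" "cup1 (d a) b \<in> carrier A"
      "cup1 (d b) a \<in> carrier A" "a \<in> carrier A" "b \<in> carrier A"
    using D2_subset_G2 da db a b cup1_closed grading_closed by blast+
  have "cup1 a (d b) = circ (d a) (d b) \<ominus>\<^bsub>A\<^esub> cup1 (d b) a"
    by (rule cup1_eq_circ_minus_on_D2[OF bil circ a da left[OF a _ _ da] db])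
  then show "d (cup1 a b) = \<ominus>\<^bsub>A\<^esub> (a \<otimes>\<^bsub>A\<^esub> b) \<ominus>\<^bsub>A\<^esub> b \<otimes>\<^bsub>A\<^esub> a \<oplus>\<^bsub>A\<^esub> cup1 (d a) b \<oplus>\<^bsub>A\<^esub> cup1 (d b) a
      \<ominus>\<^bsub>A\<^esub> circ (d a) (d b)"
    using closed by (simp add: d_cup1[OF a b] a_minus_def M.minus_add M.a_ac)
qed

lemma (in steenrod_dga) d_cup_1:
  assumes a: "a \<in> G 1" and b: "b \<in> G 1"
  shows "d (cup 1 a b) =
    \<ominus>\<^bsub>A\<^esub> (a \<otimes>\<^bsub>A\<^esub> b) \<ominus>\<^bsub>A\<^esub> b \<otimes>\<^bsub>A\<^esub> a \<oplus>\<^bsub>A\<^esub> cup 1 (d a) b \<ominus>\<^bsub>A\<^esub> cup 1 a (d b)"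
  using steenrod_d[OF a b, of 1] steenrod_0[OF a b] steenrod_0[OF b a]
  by (simp add: signed_def a_minus_def)

theorem lemma3p8:
  fixes R :: "('r, 'm) ring_scheme" and A :: "('r, 'a, 'n) module_scheme"
    and G :: "nat \<Rightarrow> 'a set" and d :: "'a \<Rightarrow> 'a"
  shows
    "(\<forall>cup1 circ.
        dga R A G d \<and> cup_one_algebra R A G cup1 \<and>
        bilinear_on R A (G 1) (G 2) (G 2) cup1 \<and>
        circ_product R A G cup1 circ \<and>
        (\<forall>a\<in>G 1. \<forall>b\<in>G 1. \<forall>c\<in>G 1. d a \<in> D2 R A G \<longrightarrow>
          cup1 a (b \<otimes>\<^bsub>A\<^esub> c) = circ (d a) (b \<otimes>\<^bsub>A\<^esub> c) \<ominus>\<^bsub>A\<^esub> cup1 (b \<otimes>\<^bsub>A\<^esub> c) a) \<and>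
        (\<forall>a\<in>G 1. \<forall>b\<in>G 1.
          d (cup1 a b) =
            \<ominus>\<^bsub>A\<^esub> (a \<otimes>\<^bsub>A\<^esub> b) \<ominus>\<^bsub>A\<^esub> b \<otimes>\<^bsub>A\<^esub> a \<oplus>\<^bsub>A\<^esub> cup1 (d a) b \<ominus>\<^bsub>A\<^esub> cup1 a (d b))
        \<longrightarrow>
        (\<forall>a\<in>G 1. \<forall>b\<in>G 1. d a \<in> D2 R A G \<longrightarrow> d b \<in> D2 R A G \<longrightarrow>
          d (cup1 a b) =
            \<ominus>\<^bsub>A\<^esub> (a \<otimes>\<^bsub>A\<^esub> b) \<ominus>\<^bsub>A\<^esub> b \<otimes>\<^bsub>A\<^esub> a \<oplus>\<^bsub>A\<^esub> cup1 (d a) b \<oplus>\<^bsub>A\<^esub> cup1 (d b) a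
              \<ominus>\<^bsub>A\<^esub> circ (d a) (d b)) \<and>
        cup1_dga R A G d cup1) \<and>
     (\<forall>cup circ.
        steenrod_dga R A G d cup \<and> cup_one_algebra R A G (cup 1) \<and>
        circ_product R A G (cup 1) circ \<and>
        (\<forall>a\<in>G 1. \<forall>b\<in>G 1. \<forall>c\<in>G 1. d a \<in> D2 R A G \<longrightarrow>
          cup 1 a (b \<otimes>\<^bsub>A\<^esub> c) = circ (d a) (b \<otimes>\<^bsub>A\<^esub> c) \<ominus>\<^bsub>A\<^esub> cup 1 (b \<otimes>\<^bsub>A\<^esub> c) a)
        \<longrightarrow>
        cup1_dga R A G d (cup 1))"
proof (intro conjI allI impI)
  fix cup1 circ
  assume H: "dga R A G d \<and> cup_one_algebra R A G cup1 \<and>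
        bilinear_on R A (G 1) (G 2) (G 2) cup1 \<and>
        circ_product R A G cup1 circ \<and>
        (\<forall>a\<in>G 1. \<forall>b\<in>G 1. \<forall>c\<in>G 1. d a \<in> D2 R A G \<longrightarrow>
          cup1 a (b \<otimes>\<^bsub>A\<^esub> c) = circ (d a) (b \<otimes>\<^bsub>A\<^esub> c) \<ominus>\<^bsub>A\<^esub> cup1 (b \<otimes>\<^bsub>A\<^esub> c) a) \<and>
        (\<forall>a\<in>G 1. \<forall>b\<in>G 1.
          d (cup1 a b) =
            \<ominus>\<^bsub>A\<^esub> (a \<otimes>\<^bsub>A\<^esub> b) \<ominus>\<^bsub>A\<^esub> b \<otimes>\<^bsub>A\<^esub> a \<oplus>\<^bsub>A\<^esub> cup1 (d a) b \<ominus>\<^bsub>A\<^esub> cup1 a (d b))"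
  have formula: "cup1_d_formula R A G d cup1 circ"
    by (rule cup1_d_formula_if_left_formula) (use H in blast)+
  then show "\<forall>a\<in>G 1. \<forall>b\<in>G 1. d a \<in> D2 R A G \<longrightarrow> d b \<in> D2 R A G \<longrightarrow>
          d (cup1 a b) =
            \<ominus>\<^bsub>A\<^esub> (a \<otimes>\<^bsub>A\<^esub> b) \<ominus>\<^bsub>A\<^esub> b \<otimes>\<^bsub>A\<^esub> a \<oplus>\<^bsub>A\<^esub> cup1 (d a) b \<oplus>\<^bsub>A\<^esub> cup1 (d b) a
              \<ominus>\<^bsub>A\<^esub> circ (d a) (d b)"
    by (simp only: cup1_d_formula_def)
  show "cup1_dga R A G d cup1"
    using H formula by (auto intro!: cup1_dga.intro cup1_dga_axioms.intro)
next
  fix cup circ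
  assume H: "steenrod_dga R A G d cup \<and> cup_one_algebra R A G (cup 1) \<and>
        circ_product R A G (cup 1) circ \<and>
        (\<forall>a\<in>G 1. \<forall>b\<in>G 1. \<forall>c\<in>G 1. d a \<in> D2 R A G \<longrightarrow>
          cup 1 a (b \<otimes>\<^bsub>A\<^esub> c) = circ (d a) (b \<otimes>\<^bsub>A\<^esub> c) \<ominus>\<^bsub>A\<^esub> cup 1 (b \<otimes>\<^bsub>A\<^esub> c) a)"
  interpret steenrod_dga R A G d cup
    using H by blast
  have bil: "bilinear_on R A (G 1) (G 2) (G 2) (cup 1)"
    using steenrod_bilinear[of 1 1 2] by (simp add: numeral_2_eq_2)
  have "cup1_d_formula R A G d (cup 1) circ"
    by (rule cup1_d_formula_if_left_formula[OF dga_axioms _ bil]) (use H d_cup_1 in blast)+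
  then show "cup1_dga R A G d (cup 1)"
    using H dga_axioms by (auto intro!: cup1_dga.intro cup1_dga_axioms.intro)
qed

end
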